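(* Let $(X,d)$ be a nonempty separable complete metric space, and let $(\Omega,\mathfrak F)$ be a measurable space. Suppose that $F:X\times\Omega\to X$ satisfies: (a) for every $x\in X$, the map $\omega\mapsto F(x,\omega)$ is $(\mathfrak F,\mathfrak B(X))$-measurable; (b) there exists $\varkappa\in[0,1)$ such that $d(F(x,\omega),F(y,\omega))\le\varkappa\,d(x,y)$ for all $x,y\in X$ and $\omega\in\Omega$. Then each $F(\cdot,\omega)$ has a unique fixed point $x^\omega$, and the map $\Omega\ni\omega\mapsto x^\omega\in X$ is $(\mathfrak F,\mathfrak B(X))$-measurable.
   Context: $\mathfrak B(X)$ denotes the Borel $\sigma$-algebra of $X$. *)

theory Defs
  imports "HOL-Analysis.Analysis"
begin

text \<open>The library constant \<^const>\<open>borel\<close> only covers topologies given by a type class; this is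
  the Borel sigma-algebra of a topology with an explicit carrier.\<close>

definition borel_of :: "'a topology \<Rightarrow> 'a measure" where
  "borel_of T = sigma (topspace T) {U. openin T U}"

lemma space_borel_of [simp]: "space (borel_of T) = topspace T"
  by (simp add: borel_of_def space_measure_of_conv)

lemma sets_borel_of: "sets (borel_of T) = sigma_sets (topspace T) {U. openin T U}"
  unfolding borel_of_def
  by (rule sets_measure_of) (auto dest: openin_subset)

lemma borel_of_euclidean: "borel_of euclidean = borel"
  by (simp add: borel_of_def borel_def)

end

theory Submission
  imports Defs
begin

text \<open>
  Existence and uniqueness for each \<open>\<omega>\<close> are Banach's theorem. Measurability follows from the
  fact that the fixed point can be located approximately by evaluating the map once: the distance from any point \<open>q\<close> to the fixed point of a contraction \<open>f\<close> is at least
  \<open>d q (f q) / (1 + \<kappa>)\<close> and at most \<open>d q (f q) / (1 - \<kappa>)\<close>, so the displacement \<open>d q (f q)\<close> locates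
  the fixed point. Consequently the fixed point lies in an open set \<open>U\<close> exactly when some point
  \<open>q\<close> of a dense set satisfies \<open>d q (f q) < (1 - \<kappa>) * r\<close> for a rational \<open>r\<close> such that the ball of
  radius \<open>r\<close> about \<open>q\<close> is contained in \<open>U\<close> (lemma \<open>fixpoint_in_open_iff\<close>). When \<open>f\<close> is
  \<open>F (-, \<omega>)\<close> with \<open>q\<close> kept fixed, this condition puts \<open>F (q, \<omega>)\<close> in a ball about \<open>q\<close>, which
  is a measurable condition on \<open>\<omega>\<close>. Separability leaves only countably many pairs \<open>(q, r)\<close>, and
  these do not depend on \<open>\<omega>\<close>, so the preimage of \<open>U\<close> is a countable union of measurable sets.
\<close>

context Metric_space
begin

text \<open>Both estimates come from the triangle inequality through the images of \<open>q\<close> and of the fixed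
  point. The first serves to show that a small displacement forces the fixed point to be near; the
  second, that points close to the fixed point do have small displacement.\<close>

lemma fixpoint_dist_le_displacement:
  assumes f: "f \<in> M \<rightarrow> M" and q: "q \<in> M" and p: "p \<in> M" "f p = p"
    and contr: "\<And>x y. x \<in> M \<Longrightarrow> y \<in> M \<Longrightarrow> d (f x) (f y) \<le> \<kappa> * d x y"
  shows "(1 - \<kappa>) * d q p \<le> d q (f q)"
proof -
  have "d q p \<le> d q (f q) + d (f q) (f p)"
    using triangle[of q "f q" p] f q p by (simp add: Pi_iff)
  with contr[OF q p(1)] show ?thesis by (simp add: algebra_simps)
qed

lemma displacement_le_fixpoint_dist:
  assumes f: "f \<in> M \<rightarrow> M" and q: "q \<in> M" and p: "p \<in> M" "f p = p"
    and contr: "\<And>x y. x \<in> M \<Longrightarrow> y \<in> M \<Longrightarrow> d (f x) (f y) \<le> \<kappa> * d x y"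
  shows "d q (f q) \<le> (1 + \<kappa>) * d q p"
proof -
  have "d q (f q) \<le> d q p + d (f p) (f q)"
    using triangle[of q p "f q"] f q p by (simp add: Pi_iff)
  with contr[OF p(1) q] show ?thesis by (simp add: commute algebra_simps)
qed

text \<open>Only the clause \<open>d q (f q) < (1 - \<kappa>) * r\<close> involves \<open>f\<close>, and it does so through the single
  value \<open>f q\<close>; this is what makes the criterion measurable in a parameter of \<open>f\<close>.
  That clause also forces \<open>r > 0\<close>, the displacement being nonnegative.\<close>

lemma fixpoint_in_open_iff:
  assumes f: "f \<in> M \<rightarrow> M" and p: "p \<in> M" "f p = p"
    and \<kappa>: "0 \<le> \<kappa>" "\<kappa> < 1"
    and contr: "\<And>x y. x \<in> M \<Longrightarrow> y \<in> M \<Longrightarrow> d (f x) (f y) \<le> \<kappa> * d x y"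
    and D: "D \<subseteq> M" "mtopology closure_of D = M"
    and U: "openin mtopology U"
  shows "p \<in> U \<longleftrightarrow> (\<exists>q\<in>D. \<exists>r\<in>\<rat>. mball q r \<subseteq> U \<and> d q (f q) < (1 - \<kappa>) * r)"
proof
  assume "p \<in> U"
  then obtain e where e: "e > 0" "mball p e \<subseteq> U"
    using U unfolding openin_mtopology by blast
  \<comment> \<open>A point \<open>q\<close> within \<open>e / 2\<close> of \<open>p\<close> has its ball of radius \<open>r < e / 2\<close> inside \<open>U\<close>.\<close>
  obtain r where r: "r \<in> \<rat>" "0 < r" "r < e / 2"
    using Rats_dense_in_real[of 0 "e / 2"] e by auto
  \<comment> \<open>Displacement grows by at most the factor \<open>1 + \<kappa> < 2\<close> over the distance to \<open>p\<close>, so this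
    distance from \<open>p\<close> keeps it below \<open>(1 - \<kappa>) * r\<close>.\<close>
  define s where "s = (1 - \<kappa>) * r / 2"
  have s: "0 < s" "s \<le> r"
    using r \<kappa> mult_right_mono[of "1 - \<kappa>" 1 r] by (auto simp: s_def)
  have "p \<in> mtopology closure_of D"
    using D p by simp
  then obtain q where q: "q \<in> D" "q \<in> mball p s"
    using s unfolding metric_closure_of by blast
  then have qM: "q \<in> M" and qp: "d q p < s"
    by (auto simp: commute)
  have "mball q r \<subseteq> mball p e"
  proof
    fix x assume x: "x \<in> mball q r"
    then have "d p x \<le> d q p + d q x"
      using triangle[of p q x] p by (simp add: commute)
    then show "x \<in> mball p e"
      using x p qp s r by simp
  qed
  moreover have "d q (f q) < (1 - \<kappa>) * r"
  proof -
    have "d q (f q) \<le> (1 + \<kappa>) * d q p"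
      by (rule displacement_le_fixpoint_dist[OF f qM p contr])
    also have "\<dots> \<le> 2 * d q p"
      using \<kappa> by (intro mult_right_mono) auto
    also have "\<dots> < (1 - \<kappa>) * r"
      using qp by (simp add: s_def)
    finally show ?thesis .
  qed
  ultimately show "\<exists>q\<in>D. \<exists>r\<in>\<rat>. mball q r \<subseteq> U \<and> d q (f q) < (1 - \<kappa>) * r"
    using q r e by blast
next
  assume "\<exists>q\<in>D. \<exists>r\<in>\<rat>. mball q r \<subseteq> U \<and> d q (f q) < (1 - \<kappa>) * r"
  then obtain q r where q: "q \<in> D" "mball q r \<subseteq> U" "d q (f q) < (1 - \<kappa>) * r"
    by blast
  have qM: "q \<in> M"
    using q D by blast
  have "(1 - \<kappa>) * d q p < (1 - \<kappa>) * r"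
    using fixpoint_dist_le_displacement[OF f qM p contr] q by simp
  then have "p \<in> mball q r"
    using \<kappa> p qM by simp
  with q show "p \<in> U" by blast
qed

text \<open>By the criterion above, the preimage under \<open>p\<close> of an open set is a union of preimages of balls
  under the maps \<open>\<omega> \<mapsto> F \<omega> q\<close>; the index set is countable because \<open>q\<close> runs over a countable
  dense set and \<open>r\<close> over the rationals, with the condition \<open>mball q r \<subseteq> U\<close> independent of \<open>\<omega>\<close>.\<close>

lemma measurable_fixpoint:
  assumes sep: "separable_space mtopology"
    and F: "\<And>\<omega>. \<omega> \<in> space N \<Longrightarrow> F \<omega> \<in> M \<rightarrow> M"
    and meas: "\<And>x. x \<in> M \<Longrightarrow> (\<lambda>\<omega>. F \<omega> x) \<in> N \<rightarrow>\<^sub>M borel_of mtopology"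
    and \<kappa>: "0 \<le> \<kappa>" "\<kappa> < 1"
    and contr: "\<And>\<omega> x y. \<omega> \<in> space N \<Longrightarrow> x \<in> M \<Longrightarrow> y \<in> M \<Longrightarrow> d (F \<omega> x) (F \<omega> y) \<le> \<kappa> * d x y"
    and p: "\<And>\<omega>. \<omega> \<in> space N \<Longrightarrow> p \<omega> \<in> M" "\<And>\<omega>. \<omega> \<in> space N \<Longrightarrow> F \<omega> (p \<omega>) = p \<omega>"
  shows "p \<in> N \<rightarrow>\<^sub>M borel_of mtopology"
proof (rule measurable_sigma_sets[OF sets_borel_of])
  show "{U. openin mtopology U} \<subseteq> Pow (topspace mtopology)"
    using openin_subset by blast
  show "p \<in> space N \<rightarrow> topspace mtopology"
    using p by simp
  fix U assume "U \<in> {U. openin mtopology U}"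
  then have U: "openin mtopology U" by simp
  obtain D where D: "countable D" "D \<subseteq> M" "mtopology closure_of D = M"
    using sep by (auto simp: separable_space_def)
  define A where
    "A q r = (\<lambda>\<omega>. F \<omega> q) -` mball q ((1 - \<kappa>) * r) \<inter> space N" for q r
  have A: "A q r \<in> sets N" if "q \<in> D" for q r
  proof -
    have "mball q ((1 - \<kappa>) * r) \<in> sets (borel_of mtopology)"
      by (simp add: sets_borel_of sigma_sets.Basic)
    then show ?thesis
      unfolding A_def using meas that D by (blast intro: measurable_sets)
  qed
  have A_space: "A q r \<subseteq> space N" for q r
    by (auto simp: A_def)
  have "p \<omega> \<in> U \<longleftrightarrow> (\<exists>q\<in>D. \<exists>r\<in>{r\<in>\<rat>. mball q r \<subseteq> U}. \<omega> \<in> A q r)"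
    if \<omega>: "\<omega> \<in> space N" for \<omega>
  proof -
    have "\<omega> \<in> A q r \<longleftrightarrow> d q (F \<omega> q) < (1 - \<kappa>) * r" if "q \<in> D" for q r
      using that \<omega> D F[OF \<omega>] by (auto simp: A_def)
    moreover have "p \<omega> \<in> U \<longleftrightarrow> (\<exists>q\<in>D. \<exists>r\<in>\<rat>. mball q r \<subseteq> U \<and> d q (F \<omega> q) < (1 - \<kappa>) * r)"
      using F[OF \<omega>] p[OF \<omega>] \<kappa> contr[OF \<omega>] D(2,3) U by (rule fixpoint_in_open_iff)
    ultimately show ?thesis by auto
  qed
  then have "p -` U \<inter> space N = (\<Union>q\<in>D. \<Union>r\<in>{r\<in>\<rat>. mball q r \<subseteq> U}. A q r)"
    unfolding set_eq_iff Int_iff vimage_eq UN_iff using A_space by blast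
  also have "\<dots> \<in> sets N"
  proof (intro sets.countable_UN'')
    show "countable {r \<in> \<rat>. mball q r \<subseteq> U}" for q
      by (rule countable_subset[OF _ countable_rat]) auto
  qed (use A D in simp_all)
  finally show "p -` U \<inter> space N \<in> sets N" .
qed

end

theorem theorem7p2:
  fixes X :: "'a set" and d :: "'a \<Rightarrow> 'a \<Rightarrow> real"
    and \<Omega> :: "'w measure"
    and F :: "'a \<times> 'w \<Rightarrow> 'a"
  assumes metric: "Metric_space X d"
    and nonempty: "X \<noteq> {}"
    and separable: "separable_space (Metric_space.mtopology X d)"
    and complete: "Metric_space.mcomplete X d"
    and maps: "F \<in> X \<times> space \<Omega> \<rightarrow> X"
    and meas: "\<And>x. x \<in> X \<Longrightarrow>
      (\<lambda>\<omega>. F (x, \<omega>)) \<in> \<Omega> \<rightarrow>\<^sub>M borel_of (Metric_space.mtopology X d)"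
    and contraction: "\<exists>\<kappa>\<in>{0..<1::real}. \<forall>x\<in>X. \<forall>y\<in>X. \<forall>\<omega>\<in>space \<Omega>.
      d (F (x, \<omega>)) (F (y, \<omega>)) \<le> \<kappa> * d x y"
  shows "(\<forall>\<omega>\<in>space \<Omega>. \<exists>!x. x \<in> X \<and> F (x, \<omega>) = x) \<and>
    (\<lambda>\<omega>. THE x. x \<in> X \<and> F (x, \<omega>) = x)
      \<in> \<Omega> \<rightarrow>\<^sub>M borel_of (Metric_space.mtopology X d)"
proof -
  interpret Metric_space X d by (rule metric)
  obtain \<kappa> where \<kappa>: "0 \<le> \<kappa>" "\<kappa> < 1"
    and contr: "\<And>\<omega> x y. \<omega> \<in> space \<Omega> \<Longrightarrow> x \<in> X \<Longrightarrow> y \<in> X \<Longrightarrow>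
      d (F (x, \<omega>)) (F (y, \<omega>)) \<le> \<kappa> * d x y"
    using contraction by auto
  have self: "(\<lambda>x. F (x, \<omega>)) \<in> X \<rightarrow> X" if "\<omega> \<in> space \<Omega>" for \<omega>
    using maps that by auto
  have unique: "\<exists>!x. x \<in> X \<and> F (x, \<omega>) = x" if \<omega>: "\<omega> \<in> space \<Omega>" for \<omega>
  proof -
    obtain x where "x \<in> X" "F (x, \<omega>) = x"
      by (rule Banach_fixedpoint_thm[OF complete nonempty self[OF \<omega>] \<kappa>(2) contr[OF \<omega>]])
    then show ?thesis
      using contraction_imp_unique_fixpoint[OF _ _ self[OF \<omega>] \<kappa>(2) contr[OF \<omega>]] by blast
  qed
  have fixed: "(THE x. x \<in> X \<and> F (x, \<omega>) = x) \<in> X"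
    "F (THE x. x \<in> X \<and> F (x, \<omega>) = x, \<omega>) = (THE x. x \<in> X \<and> F (x, \<omega>) = x)"
    if "\<omega> \<in> space \<Omega>" for \<omega>
    using theI'[OF unique[OF that]] by simp_all
  have "(\<lambda>\<omega>. THE x. x \<in> X \<and> F (x, \<omega>) = x) \<in> \<Omega> \<rightarrow>\<^sub>M borel_of mtopology"
    by (rule measurable_fixpoint[where F = "\<lambda>\<omega> x. F (x, \<omega>)", OF separable self meas \<kappa> contr fixed])
  with unique show ?thesis by blast
qed

end
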